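(* Let $\mu,L_0>0$ and $a\in(0,1]$, and let $f:\mathbb{R}^d\to\mathbb{R}$ be continuously differentiable with a unique global minimizer $x^\ast$, with $f\in\mathrm{PL}^\mu\cap\mathrm{AC}^a\cap\mathrm{QG}_+^{L_0}$. Let $\mu_0:=\sup\{\mu'\ge\mu: f\in\mathrm{QG}_-^{\mu'}\}$. Then for all $x\in\mathbb{R}^d$, $$f^\ast\ \ge\ f(x)+\frac1a\sqrt{\frac{L_0}{\mu}}\,\langle\nabla f(x),x^\ast-x\rangle+\frac{\sqrt{\mu\mu_0}}{2}\|x-x^\ast\|^2 .$$ That is, $f\in\mathrm{SQC}_{\tau}^{\mu''}$ with $\tau=a\sqrt{\mu/L_0}$ and $\mu''=\sqrt{\mu\mu_0}$.
   Context: Notation: $f^\ast=\min f=f(x^\ast)$. Function classes: - $\mathrm{PL}^\mu$: $\|\nabla f(x)\|^2\ge2\mu(f(x)-f^\ast)$ for all $x$. - $\mathrm{AC}^a$ (aiming condition, $a\in(0,1]$): $\langle\nabla f(x),x-x^\ast\rangle\ge a\|\nabla f(x)\|\|x-x^\ast\|$ for all $x$. - $\mathrm{QG}_+^{L_0}$: $f(x)-f^\ast\le\frac{L_0}{2}\|x-x^\ast\|^2$ for all $x$. - $\mathrm{QG}_-^{\mu'}$: $f(x)-f^\ast\ge\frac{\mu'}{2}\|x-x^\ast\|^2$ for all $x$. - $\mathrm{SQC}_\tau^{\mu''}$ ($(\tau,\mu'')\in(0,1]\times(0,\infty)$): $f^\ast\ge f(x)+\frac1\tau\langle\nabla f(x),x^\ast-x\rangle+\frac{\mu''}{2}\|x-x^\ast\|^2$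 for all $x$. It is a known fact that a function in $\mathrm{PL}^\mu$ with unique minimizer lies in $\mathrm{QG}_-^{\mu}$, so the set defining $\mu_0$ is nonempty. *)

theory Defs
  imports "HOL-Analysis.Analysis"
begin

(* Meaningful only where f is differentiable; the gradient is then unique. *)
definition grad :: "(real ^ 'd \<Rightarrow> real) \<Rightarrow> real ^ 'd \<Rightarrow> real ^ 'd" where
  "grad f x = (THE g. GDERIV f x :> g)"

definition continuously_differentiable :: "(real ^ 'd \<Rightarrow> real) \<Rightarrow> bool" where
  "continuously_differentiable f \<longleftrightarrow>
     f differentiable_on UNIV \<and> continuous_on UNIV (grad f)"

definition unique_global_minimizer :: "(real ^ 'd \<Rightarrow> real) \<Rightarrow> real ^ 'd \<Rightarrow> bool" where
  "unique_global_minimizer f xs \<longleftrightarrow>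
     is_arg_min f (\<lambda>_. True) xs \<and> (\<forall>y. is_arg_min f (\<lambda>_. True) y \<longrightarrow> y = xs)"

(* The function classes below take the minimizer x* as the argument xs, and f* is f xs.
   They carry only the inequalities: the ranges of the parameters, the smoothness of f and
   the minimality of xs are stated where the classes are used. *)

definition PL :: "real ^ 'd \<Rightarrow> real \<Rightarrow> (real ^ 'd \<Rightarrow> real) set" where
  "PL xs \<mu> = {f. \<forall>x. (norm (grad f x))\<^sup>2 \<ge> 2 * \<mu> * (f x - f xs)}"

definition AC :: "real ^ 'd \<Rightarrow> real \<Rightarrow> (real ^ 'd \<Rightarrow> real) set" where
  "AC xs a = {f. \<forall>x. grad f x \<bullet> (x - xs) \<ge> a * norm (grad f x) * norm (x - xs)}"

definition QG_plus :: "real ^ 'd \<Rightarrow> real \<Rightarrow> (real ^ 'd \<Rightarrow> real) set" where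
  "QG_plus xs L\<^sub>0 = {f. \<forall>x. f x - f xs \<le> L\<^sub>0 / 2 * (norm (x - xs))\<^sup>2}"

definition QG_minus :: "real ^ 'd \<Rightarrow> real \<Rightarrow> (real ^ 'd \<Rightarrow> real) set" where
  "QG_minus xs \<mu>' = {f. \<forall>x. f x - f xs \<ge> \<mu>' / 2 * (norm (x - xs))\<^sup>2}"

definition SQC :: "real ^ 'd \<Rightarrow> real \<Rightarrow> real \<Rightarrow> (real ^ 'd \<Rightarrow> real) set" where
  "SQC xs \<tau> \<mu>'' =
     {f. \<forall>x. f xs \<ge> f x + 1 / \<tau> * (grad f x \<bullet> (xs - x)) + \<mu>'' / 2 * (norm (x - xs))\<^sup>2}"

(* A supremum of reals, hence unspecified if the set is empty or unbounded above. For f in PL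
   and QG_plus with unique minimizer xs neither occurs: the set then contains \<mu> (PL and a unique
   minimizer give QG_minus), and it is bounded by the QG_plus constant because d >= 1. *)
definition best_QG_minus :: "(real ^ 'd \<Rightarrow> real) \<Rightarrow> real ^ 'd \<Rightarrow> real \<Rightarrow> real" where
  "best_QG_minus f xs \<mu> = Sup {\<mu>'. \<mu>' \<ge> \<mu> \<and> f \<in> QG_minus xs \<mu>'}"

end

theory Submission
  imports Defs
begin

text \<open>The known fact that PL and a unique minimizer give quadratic growth is obtained in Ekeland's
  manner: \<open>g = sqrt (f - f xs)\<close> has slope at least \<open>c = sqrt (\<mu> / 2)\<close> away from \<open>xs\<close>, so for
  \<open>c' < c\<close> a minimizer of \<open>\<lambda>y. g y + c' * norm (y - x)\<close> can only be \<open>xs\<close>, and comparing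
  its value there with that at \<open>x\<close> gives \<open>c' * norm (x - xs) \<le> g x\<close>.
  For the inequality itself put \<open>\<Delta> = f x - f xs\<close> and \<open>r = norm (x - xs)\<close>. By AC and PL the inner
  product term is at least \<open>sqrt (2 * L\<^sub>0 * \<Delta>) * r\<close>. One half of it dominates \<open>\<Delta>\<close> by the upper
  growth bound, the other half dominates \<open>sqrt (\<mu> * \<mu>\<^sub>0) / 2 * r\<^sup>2\<close> by the lower growth bound and
  \<open>\<mu> \<le> L\<^sub>0\<close>.\<close>

lemma norm_le_of_slope:
  fixes g :: "'a::euclidean_space \<Rightarrow> real"
  assumes cont: "continuous_on UNIV g" and nonneg: "\<And>y. g y \<ge> 0"
    and slope: "\<And>y. y \<noteq> z \<Longrightarrow> \<exists>D. GDERIV g y :> D \<and> c \<le> norm D"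
  shows "c * norm (x - z) \<le> g x"
proof (rule ccontr)
  assume "\<not> ?thesis"
  then have *: "g x < c * norm (x - z)" by simp
  with nonneg[of x] have "norm (x - z) \<noteq> 0" by auto
  then have pos: "norm (x - z) > 0" by simp
  have "g x / norm (x - z) < c" using * pos by (simp add: field_simps)
  \<comment> \<open>The lower bound on \<open>c'\<close> will exclude \<open>z\<close> as a
    minimizer of the penalized function, the upper bound every other point.\<close>
  then obtain c' where c': "g x / norm (x - z) < c'" "c' < c"
    using dense by blast
  have "c' > 0" using nonneg[of x] pos by (intro le_less_trans[OF _ c'(1)]) simp
  define h where "h y = g y + c' * norm (y - x)" for y
  have cont_h: "continuous_on S h" for S
    unfolding h_def by (intro continuous_intros continuous_on_subset[OF cont]) auto
  \<comment> \<open>Outside the ball of radius \<open>g x / c'\<close> the penalty alone exceeds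
    \<open>g x\<close>, which equals \<open>h x\<close>. A minimizer over this compact ball is
    therefore a global one.\<close>
  have "g x / c' \<ge> 0" using nonneg \<open>c' > 0\<close> by simp
  then have "cball x (g x / c') \<noteq> {}" by simp
  then obtain y where y: "y \<in> cball x (g x / c')" "\<And>w. w \<in> cball x (g x / c') \<Longrightarrow> h y \<le> h w"
    using continuous_attains_inf[OF compact_cball _ cont_h] by blast
  have min: "h y \<le> h w" for w
  proof (cases "w \<in> cball x (g x / c')")
    case False
    have "h y \<le> h x" using y(2) \<open>g x / c' \<ge> 0\<close> by simp
    also have "\<dots> \<le> c' * norm (w - x)"
      using False \<open>c' > 0\<close> by (simp add: h_def dist_norm norm_minus_commute field_simps)
    also have "\<dots> \<le> h w" using nonneg by (simp add: h_def)
    finally show ?thesis .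
  qed (use y in blast)
  show False
  proof (cases "y = z")
    case True
    then have "c' * norm (z - x) \<le> g x" using min[of x] nonneg[of z] by (simp add: h_def)
    then show False using c'(1) pos by (simp add: field_simps norm_minus_commute)
  next
    case False
    then obtain D where D: "GDERIV g y :> D" "c \<le> norm D" using slope by blast
    \<comment> \<open>The unit direction of steepest descent: along it \<open>g\<close> initially
      falls at rate \<open>norm D\<close>, while by the triangle inequality the penalty grows at
      rate at most \<open>c' < norm D\<close>. A short step thus lowers \<open>h\<close>.\<close>
    define v where "v = - sgn D"
    have "D \<noteq> 0" using D(2) \<open>c' > 0\<close> c'(2) by auto
    then have v: "norm v = 1" "v \<bullet> D = - norm D"
      by (simp_all add: v_def norm_sgn sgn_div_norm power2_norm_eq_inner[symmetric] power2_eq_square)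
    have "((\<lambda>t. y + t *\<^sub>R v) has_derivative (\<lambda>t. t *\<^sub>R v)) (at 0)"
      by (auto intro!: derivative_eq_intros)
    then have "((\<lambda>t. g (y + t *\<^sub>R v)) has_derivative (\<lambda>t. (t *\<^sub>R v) \<bullet> D)) (at 0)"
      by (rule has_derivative_compose) (use D(1) in \<open>simp add: gderiv_def\<close>)
    then have "((\<lambda>t. g (y + t *\<^sub>R v)) has_real_derivative - norm D) (at 0)"
      by (rule has_derivative_imp_has_field_derivative) (simp add: v)
    then have "((\<lambda>t. g (y + t *\<^sub>R v) + c' * t) has_real_derivative - norm D + c') (at 0)"
      by (auto intro!: derivative_eq_intros)
    moreover have "- norm D + c' < 0" using D(2) c'(2) by simp
    ultimately obtain d where d: "d > 0"
      "\<And>t. t > 0 \<Longrightarrow> t < d \<Longrightarrow> g (y + t *\<^sub>R v) + c' * t < g y"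
      by (auto dest!: DERIV_neg_dec_right)
    have "g (y + (d/2) *\<^sub>R v) + c' * (d/2) < g y" using d(1) by (intro d(2)) auto
    moreover have "norm (y + (d/2) *\<^sub>R v - x) \<le> norm (y - x) + d/2"
      using norm_triangle_ineq[of "y - x" "(d/2) *\<^sub>R v"] d(1) v(1) by (simp add: algebra_simps)
    then have "c' * norm (y + (d/2) *\<^sub>R v - x) \<le> c' * norm (y - x) + c' * (d/2)"
      using \<open>c' > 0\<close> by (metis distrib_left less_imp_le mult_left_mono)
    ultimately have "h (y + (d/2) *\<^sub>R v) < h y" by (simp add: h_def)
    with min show False by (meson not_less)
  qed
qed

text \<open>Riesz representation: the derivative \<open>f'\<close> is the inner product with
  \<open>adjoint f' 1\<close>. Since derivatives are unique, so is this vector, and the definite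
  description in \<open>grad\<close> denotes it.\<close>

lemma GDERIV_grad:
  fixes f :: "real ^ 'd \<Rightarrow> real"
  assumes "f differentiable at x"
  shows "GDERIV f x :> grad f x"
proof -
  obtain f' where f': "(f has_derivative f') (at x)" using assms by (auto simp: differentiable_def)
  then interpret bounded_linear f' by (rule has_derivative_bounded_linear)
  define g where "g = adjoint f' 1"
  have "f' = (\<lambda>h. h \<bullet> g)"
    by (rule ext) (simp add: g_def adjoint_works[OF linear_axioms])
  then have g: "GDERIV f x :> g" using f' by (simp add: gderiv_def)
  moreover have "g' = g" if "GDERIV f x :> g'" for g'
  proof -
    have "(\<lambda>h. h \<bullet> g') = (\<lambda>h. h \<bullet> g)"
      using that g by (auto simp: gderiv_def intro: has_derivative_unique)
    then show ?thesis using vector_eq_ldot[of g' g] by (simp add: fun_eq_iff)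
  qed
  ultimately show ?thesis unfolding grad_def by (rule theI)
qed

lemma PL_imp_QG_minus:
  assumes "\<mu> > 0" and diff: "f differentiable_on UNIV"
    and min: "unique_global_minimizer f xs" and PL: "f \<in> PL xs \<mu>"
  shows "f \<in> QG_minus xs \<mu>"
proof -
  have le: "f xs \<le> f y" for y
    using min by (auto simp: unique_global_minimizer_def is_arg_min_linorder)
  have less: "f xs < f y" if "y \<noteq> xs" for y
    using min that le unfolding unique_global_minimizer_def is_arg_min_linorder
    by (metis less_le order_refl)
  define g where "g y = sqrt (f y - f xs)" for y
  have "sqrt (\<mu> / 2) * norm (x - xs) \<le> g x" for x
  proof (rule norm_le_of_slope)
    show "continuous_on UNIV g"
      unfolding g_def using differentiable_imp_continuous_on[OF diff] by (intro continuous_intros)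
  next
    fix y assume "y \<noteq> xs"
    then have pos: "f y - f xs > 0" using less by simp
    have "GDERIV f y :> grad f y" using diff by (auto intro: GDERIV_grad simp: differentiable_on_def)
    then have "GDERIV (\<lambda>y. f y - f xs) y :> grad f y"
      by (auto intro!: derivative_eq_intros simp: gderiv_def)
    moreover have "DERIV sqrt (f y - f xs) :> inverse (sqrt (f y - f xs)) / 2"
      using pos by (rule DERIV_real_sqrt)
    ultimately have "GDERIV g y :> (inverse (sqrt (f y - f xs)) / 2) *\<^sub>R grad f y"
      unfolding g_def by (intro GDERIV_DERIV_compose)
    moreover have "sqrt (\<mu> / 2) \<le> norm ((inverse (sqrt (f y - f xs)) / 2) *\<^sub>R grad f y)"
    proof (rule real_le_lsqrt)
      \<comment> \<open>The squared norm of the gradient of \<open>g\<close> is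
        \<open>(norm (grad f y))\<^sup>2 / (4 * (f y - f xs))\<close>, and PL bounds the
        numerator.\<close>
      have "2 * \<mu> * (f y - f xs) \<le> (norm (grad f y))\<^sup>2" using PL by (simp add: PL_def)
      then show "\<mu> / 2 \<le> (norm ((inverse (sqrt (f y - f xs)) / 2) *\<^sub>R grad f y))\<^sup>2"
        using pos by (simp add: power_mult_distrib power_divide field_simps)
    qed (use pos \<open>\<mu> > 0\<close> in auto)
    ultimately show "\<exists>D. GDERIV g y :> D \<and> sqrt (\<mu> / 2) \<le> norm D" by blast
  qed (use le in \<open>auto simp: g_def\<close>)
  then have "(sqrt (\<mu> / 2) * norm (x - xs))\<^sup>2 \<le> (g x)\<^sup>2" for x
    using \<open>\<mu> > 0\<close> by (intro power_mono) auto
  then show ?thesis using le \<open>\<mu> > 0\<close> by (simp add: QG_minus_def g_def power_mult_distrib)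
qed

text \<open>Both growth bounds are compared at a point at distance 1 from \<open>xs\<close>, which
  exists because the dimension is at least 1.\<close>

lemma QG_minus_le_QG_plus:
  fixes xs :: "real ^ 'd"
  assumes "f \<in> QG_minus xs m" and "f \<in> QG_plus xs L"
  shows "m \<le> L"
proof -
  obtain e :: "real ^ 'd" where "norm e = 1" using vector_choose_size[of 1] by auto
  then have "m / 2 \<le> f (xs + e) - f xs" "f (xs + e) - f xs \<le> L / 2"
    using assms by (auto simp: QG_minus_def QG_plus_def dest!: spec[of _ "xs + e"])
  then show ?thesis by linarith
qed

text \<open>The supremum is attained: the admissible constants form a closed set that contains
  \<open>\<mu>\<close> and is bounded above by \<open>L\<close>.\<close>

lemma best_QG_minus_bounds:
  assumes "f \<in> QG_minus xs \<mu>" and plus: "f \<in> QG_plus xs L"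
  shows "\<mu> \<le> best_QG_minus f xs \<mu>" and "f \<in> QG_minus xs (best_QG_minus f xs \<mu>)"
proof -
  define S where "S = {\<mu>'. \<mu>' \<ge> \<mu> \<and> f \<in> QG_minus xs \<mu>'}"
  have best: "best_QG_minus f xs \<mu> = Sup S" by (simp add: best_QG_minus_def S_def)
  have mem: "\<mu> \<in> S" using assms by (simp add: S_def)
  have bdd: "bdd_above S"
    by (rule bdd_aboveI[of _ L]) (use plus in \<open>auto simp: S_def intro: QG_minus_le_QG_plus\<close>)
  show "\<mu> \<le> best_QG_minus f xs \<mu>" unfolding best using mem bdd by (rule cSup_upper)
  \<comment> \<open>For each fixed \<open>x\<close> the growth condition is a weak linear inequality
    in the constant, hence closed.\<close>
  have "S = {\<mu>..} \<inter> (\<Inter>x. {m. m / 2 * (norm (x - xs))\<^sup>2 \<le> f x - f xs})"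
    by (auto simp: S_def QG_minus_def)
  also have "closed \<dots>"
    by (intro closed_Int closed_atLeast closed_INT ballI closed_Collect_le continuous_intros) auto
  finally have "closed S" .
  then have "Sup S \<in> S" using mem bdd by (intro closed_contains_Sup) auto
  then show "f \<in> QG_minus xs (best_QG_minus f xs \<mu>)" by (simp add: best S_def)
qed

lemma strong_quasar_inequality:
  assumes "0 < \<mu>" "\<mu> \<le> L" "0 < a" "0 \<le> m" "\<And>y. f xs \<le> f y"
    and "f \<in> PL xs \<mu>" "f \<in> AC xs a" "f \<in> QG_plus xs L" "f \<in> QG_minus xs m"
  shows "f xs \<ge> f x + 1 / a * sqrt (L / \<mu>) * (grad f x \<bullet> (xs - x))
                  + sqrt (\<mu> * m) / 2 * (norm (x - xs))\<^sup>2"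
proof -
  define \<Delta> r G where "\<Delta> = f x - f xs" and "r = norm (x - xs)" and "G = norm (grad f x)"
  have nn: "\<Delta> \<ge> 0" "r \<ge> 0" "G \<ge> 0" using assms(5) by (simp_all add: \<Delta>_def r_def G_def)
  have PL: "sqrt (2 * \<mu> * \<Delta>) \<le> G"
    using assms(6) nn by (intro real_le_lsqrt) (auto simp: PL_def \<Delta>_def G_def)
  have AC: "a * G * r \<le> grad f x \<bullet> (x - xs)"
    using assms(7) by (auto simp: AC_def G_def r_def)
  have "\<Delta> \<le> L / 2 * r\<^sup>2" "m / 2 * r\<^sup>2 \<le> \<Delta>"
    using assms(8,9) by (auto simp: QG_plus_def QG_minus_def \<Delta>_def r_def)
  then have "sqrt \<Delta> \<le> sqrt (L / 2 * r\<^sup>2)" "sqrt (m / 2 * r\<^sup>2) \<le> sqrt \<Delta>" by simp_all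
  then have plus: "sqrt \<Delta> \<le> sqrt (L / 2) * r" and minus: "sqrt (m / 2) * r \<le> sqrt \<Delta>"
    using nn by (simp_all only: real_sqrt_mult real_sqrt_abs abs_of_nonneg)
  \<comment> \<open>This splits the inner product bound into two equal copies of
    \<open>sqrt (L / 2) * sqrt \<Delta> * r\<close>, one for each term to be dominated.\<close>
  have half: "sqrt (2 * L) = 2 * sqrt (L / 2)"
    using real_sqrt_mult[of 4 "L / 2"] by simp
  have "sqrt \<Delta> * sqrt \<Delta> \<le> sqrt \<Delta> * (sqrt (L / 2) * r)"
    using plus nn by (intro mult_left_mono) auto
  then have upper: "\<Delta> \<le> sqrt (L / 2) * sqrt \<Delta> * r" using nn by (simp add: mult_ac)
  have "sqrt (\<mu> * m) / 2 * r\<^sup>2 = sqrt (\<mu> / 2) * (sqrt (m / 2) * r) * r"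
    by (simp add: real_sqrt_mult real_sqrt_divide power2_eq_square)
  \<comment> \<open>Here \<open>\<mu> \<le> L\<close> enlarges the first factor, and lower growth
    turns \<open>sqrt (m / 2) * r\<close> into \<open>sqrt \<Delta>\<close>.\<close>
  also have "\<dots> \<le> sqrt (L / 2) * sqrt \<Delta> * r"
    using assms(1-4) minus nn by (intro mult_right_mono mult_mono) auto
  finally have lower: "sqrt (\<mu> * m) / 2 * r\<^sup>2 \<le> sqrt (L / 2) * sqrt \<Delta> * r" .
  have "\<Delta> + sqrt (\<mu> * m) / 2 * r\<^sup>2 \<le> sqrt (2 * L) * sqrt \<Delta> * r"
    using upper lower by (simp add: half)
  \<comment> \<open>Factoring out the root that PL compares with the gradient norm leaves the
    coefficient \<open>sqrt (L / \<mu>)\<close>; the factor \<open>1 / a\<close> then offsets the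
    loss in AC.\<close>
  also have "\<dots> = sqrt (L / \<mu>) * sqrt (2 * \<mu> * \<Delta>) * r"
    using assms(1) by (simp add: real_sqrt_mult real_sqrt_divide)
  also have "\<dots> \<le> sqrt (L / \<mu>) * G * r"
    using PL assms(1,2) nn by (intro mult_right_mono mult_left_mono) auto
  also have "\<dots> = 1 / a * sqrt (L / \<mu>) * (a * G * r)" using assms(3) by simp
  also have "\<dots> \<le> 1 / a * sqrt (L / \<mu>) * (grad f x \<bullet> (x - xs))"
    using AC assms(1-3) by (intro mult_left_mono) auto
  also have "\<dots> = - (1 / a * sqrt (L / \<mu>) * (grad f x \<bullet> (xs - x)))"
    by (simp add: inner_diff_right algebra_simps diff_divide_distrib)
  finally show ?thesis by (simp add: \<Delta>_def r_def)
qed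

theorem lemma4p3:
  fixes f :: "real ^ 'd \<Rightarrow> real" and xs :: "real ^ 'd" and \<mu> L\<^sub>0 a \<mu>\<^sub>0 :: real
  assumes "\<mu> > 0" and "L\<^sub>0 > 0" and "0 < a" and "a \<le> 1"
    and "continuously_differentiable f"
    and "unique_global_minimizer f xs"
    and "f \<in> PL xs \<mu> \<inter> AC xs a \<inter> QG_plus xs L\<^sub>0"
    and "\<mu>\<^sub>0 = best_QG_minus f xs \<mu>"
  shows "(\<forall>x. f xs \<ge> f x + 1 / a * sqrt (L\<^sub>0 / \<mu>) * (grad f x \<bullet> (xs - x))
                      + sqrt (\<mu> * \<mu>\<^sub>0) / 2 * (norm (x - xs))\<^sup>2)
       \<and> 0 < a * sqrt (\<mu> / L\<^sub>0) \<and> a * sqrt (\<mu> / L\<^sub>0) \<le> 1 \<and> 0 < sqrt (\<mu> * \<mu>\<^sub>0)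
       \<and> f \<in> SQC xs (a * sqrt (\<mu> / L\<^sub>0)) (sqrt (\<mu> * \<mu>\<^sub>0))"
proof -
  have PL: "f \<in> PL xs \<mu>" and AC: "f \<in> AC xs a" and plus: "f \<in> QG_plus xs L\<^sub>0"
    using assms(7) by auto
  have min: "f xs \<le> f y" for y
    using assms(6) by (auto simp: unique_global_minimizer_def is_arg_min_linorder)
  have QG: "f \<in> QG_minus xs \<mu>"
    using PL_imp_QG_minus[OF assms(1) _ assms(6) PL] assms(5)
    by (simp add: continuously_differentiable_def)
  \<comment> \<open>Needed twice: in the inequality itself and to keep the parameter
    \<open>a * sqrt (\<mu> / L\<^sub>0)\<close> at most 1.\<close>
  have "\<mu> \<le> L\<^sub>0" using QG plus by (rule QG_minus_le_QG_plus)
  have \<mu>\<^sub>0: "\<mu> \<le> \<mu>\<^sub>0" "f \<in> QG_minus xs \<mu>\<^sub>0"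
    using best_QG_minus_bounds[OF QG plus] assms(8) by simp_all
  have ineq: "f xs \<ge> f x + 1 / a * sqrt (L\<^sub>0 / \<mu>) * (grad f x \<bullet> (xs - x))
                + sqrt (\<mu> * \<mu>\<^sub>0) / 2 * (norm (x - xs))\<^sup>2" for x
    using assms(1,3) \<mu>\<^sub>0 \<open>\<mu> \<le> L\<^sub>0\<close> min PL AC plus by (intro strong_quasar_inequality) auto
  have \<tau>: "1 / (a * sqrt (\<mu> / L\<^sub>0)) = 1 / a * sqrt (L\<^sub>0 / \<mu>)"
    by (simp add: real_sqrt_divide)
  have "sqrt (\<mu> / L\<^sub>0) \<le> 1" using \<open>\<mu> \<le> L\<^sub>0\<close> assms(2) by simp
  then have "a * sqrt (\<mu> / L\<^sub>0) \<le> 1" using assms(1-4) by (intro mult_le_one) auto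
  moreover have "f \<in> SQC xs (a * sqrt (\<mu> / L\<^sub>0)) (sqrt (\<mu> * \<mu>\<^sub>0))"
    unfolding SQC_def \<tau> using ineq by blast
  ultimately show ?thesis using ineq assms(1-3) \<mu>\<^sub>0(1) by simp
qed

end
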